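(* Let $(\gamma_s,v_1,v_2):I\to AdS^3\times\Delta_1$ be a pseudo-spherical spacelike framed curve with curvature $(\alpha,\ell,m,n)$, and let $\epsilon=\langle v_1,v_1\rangle$. Let $\phi\in\mathbb{R}$ be fixed, let $\theta:I\to\mathbb{R}$ be smooth with $\theta'=-\ell$, and let $(P,R)=(\cosh\theta,\sinh\theta)$ or $(P,R)=(\sinh\theta,\cosh\theta)$. Let $(f,g)=(\cos\phi,\sin\phi)$ if $\epsilon(P^2-R^2)=-1$ and $(f,g)=(\cosh\phi,\sinh\phi)$ if $\epsilon(P^2-R^2)=1$. Let $$\gamma_s^\phi=f\gamma_s+g(Pv_1+Rv_2)$$ be the anti-de Sitter parallel of $\gamma_s$, and put $$v_1^\phi=\epsilon(P^2-R^2)\, g\,\gamma_s+f(Pv_1+Rv_2),\qquad v_2^\phi=Rv_1+Pv_2 .$$ Then $(\gamma_s^\phi,v_1^\phi,v_2^\phi):I\to AdS^3\times\Delta_1$ is a pseudo-spherical spacelike framed curve with the curvature $(\alpha^\phi,0,m^\phi,n^\phi)$, where $$\alpha^\phi=\alpha f+g(Pm+Rn),\qquad m^\phi=\epsilon(P^2-R^2)\,g\,\alpha+f(Pm+Rn),\qquad n^\phi=Rm+Pn .$$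
   Context: $\mathbb{R}^4_2$ is $\mathbb{R}^4$ with $\langle u,w\rangle=-u_1w_1-u_2w_2+u_3w_3+u_4w_4$; the triple product $u\times v\times w$ is the unique vector with $\langle x,u\times v\times w\rangle=\det(x,u,v,w)$ for all $x$. $AdS^3=\{u:\langle u,u\rangle=-1\}$, $S^3_2=\{u:\langle u,u\rangle=1\}$, and $\Delta_1=\{(u,w):\langle u,w\rangle=0\}\subset AdS^3\times S^3_2$ (or $\subset S^3_2\times AdS^3$). $I$ is an interval. A pseudo-spherical spacelike framed curve is a smooth map $(\gamma,v_1,v_2):I\to AdS^3\times\Delta_1$ with $\langle\gamma,v_i\rangle=0$ and $\langle\gamma',v_i\rangle=0$ on $I$ for $i=1,2$. Put $\mu=\gamma\times v_1\times v_2$ and $\epsilon=\langle v_1,v_1\rangle\in\{\pm1\}$. Its curvature is $(\alpha,\ell,m,n)$ with $\alpha=\langle\gamma',\mu\rangle$, $\ell=-\epsilon\langle v_1',v_2\rangle$, $m=\langle v_1',\mu\rangle$, $n=\langle v_2',\mu\rangle$; equivalently $\gamma'=\alpha\mu$, $v_1'=\ell v_2+m\mu$, $v_2'=\ell v_1+n\mu$, $\mu'=\alpha\gamma-\epsilon m v_1+\epsilon n v_2$.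
   Formalization: The curvature proved is (P²−R²)(α^φ,0,m^φ,n^φ): as stated for (P,R)=(cosh θ,sinh θ), but with opposite sign for (sinh θ,cosh θ), where γ^φ×v_1^φ×v_2^φ=−μ and the stated formula fails, e.g. γ=(cosh t,0,sinh t,0), v_1=e_4, v_2=e_2, θ=φ=0. *)

theory Defs
  imports "HOL-Analysis.Analysis"
begin

section \<open>The semi-Euclidean space of signature (2,2)\<close>

definition pinner :: "real^4 \<Rightarrow> real^4 \<Rightarrow> real" where
  "pinner u w = - (u$1 * w$1) - u$2 * w$2 + u$3 * w$3 + u$4 * w$4"

definition triple :: "real^4 \<Rightarrow> real^4 \<Rightarrow> real^4 \<Rightarrow> real^4" where
  "triple u v w = (THE y. \<forall>x. pinner x y = det (vector [x, u, v, w] :: real^4^4))"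

definition AdS3 :: "(real^4) set" where
  "AdS3 = {u. pinner u u = -1}"

definition S32 :: "(real^4) set" where
  "S32 = {u. pinner u u = 1}"

text \<open>The same symbol \<open>\<Delta>\<^sub>1\<close> is used for a subset of \<open>AdS\<^sup>3 \<times> S\<^sup>3\<^sub>2\<close> and for a subset of
  \<open>S\<^sup>3\<^sub>2 \<times> AdS\<^sup>3\<close>; the two ambient factors are arguments here.\<close>

definition Delta1 :: "(real^4) set \<Rightarrow> (real^4) set \<Rightarrow> ((real^4) \<times> (real^4)) set" where
  "Delta1 A B = {(u, w) \<in> A \<times> B. pinner u w = 0}"

section \<open>Framed curves on an interval\<close>

text \<open>Derivatives are taken within \<open>I\<close>, hence one-sided at end points that belong to \<open>I\<close>.\<close>

definition smooth_on_interval :: "real set \<Rightarrow> (real \<Rightarrow> 'a::real_normed_vector) \<Rightarrow> bool" where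
  "smooth_on_interval I h \<longleftrightarrow>
     (\<forall>k. ((\<lambda>g t. vector_derivative g (at t within I)) ^^ k) h differentiable_on I)"

definition spacelike_framed_curve ::
  "real set \<Rightarrow> (real \<Rightarrow> real^4) \<Rightarrow> (real \<Rightarrow> real^4) \<Rightarrow> (real \<Rightarrow> real^4) \<Rightarrow> bool" where
  "spacelike_framed_curve I \<gamma> v1 v2 \<longleftrightarrow>
     smooth_on_interval I \<gamma> \<and> smooth_on_interval I v1 \<and> smooth_on_interval I v2 \<and>
     (\<forall>t\<in>I. \<gamma> t \<in> AdS3) \<and>
     ((\<forall>t\<in>I. (v1 t, v2 t) \<in> Delta1 AdS3 S32) \<or> (\<forall>t\<in>I. (v1 t, v2 t) \<in> Delta1 S32 AdS3)) \<and>
     (\<forall>t\<in>I. pinner (\<gamma> t) (v1 t) = 0 \<and> pinner (\<gamma> t) (v2 t) = 0 \<and>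
        pinner (vector_derivative \<gamma> (at t within I)) (v1 t) = 0 \<and>
        pinner (vector_derivative \<gamma> (at t within I)) (v2 t) = 0)"

text \<open>The normal \<open>\<mu>\<close> is the triple product of the frame, so its sign is not free: for
  scalars \<open>P\<close>, \<open>R\<close> one has
  \<open>\<gamma> \<times> (P v\<^sub>1 + R v\<^sub>2) \<times> (R v\<^sub>1 + P v\<^sub>2) = (P\<^sup>2 - R\<^sup>2) (\<gamma> \<times> v\<^sub>1 \<times> v\<^sub>2)\<close>,
  and reversing \<open>\<mu>\<close> changes the sign of \<open>\<alpha>\<close>, \<open>m\<close>, \<open>n\<close> but not of \<open>l\<close>.\<close>

definition has_curvature ::
  "real set \<Rightarrow> (real \<Rightarrow> real^4) \<Rightarrow> (real \<Rightarrow> real^4) \<Rightarrow> (real \<Rightarrow> real^4) \<Rightarrow>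
   (real \<Rightarrow> real) \<Rightarrow> (real \<Rightarrow> real) \<Rightarrow> (real \<Rightarrow> real) \<Rightarrow> (real \<Rightarrow> real) \<Rightarrow> bool" where
  "has_curvature I \<gamma> v1 v2 \<alpha> l m n \<longleftrightarrow>
     (\<forall>t\<in>I. let \<mu> = triple (\<gamma> t) (v1 t) (v2 t); \<epsilon> = pinner (v1 t) (v1 t) in
        \<alpha> t = pinner (vector_derivative \<gamma> (at t within I)) \<mu> \<and>
        l t = - \<epsilon> * pinner (vector_derivative v1 (at t within I)) (v2 t) \<and>
        m t = pinner (vector_derivative v1 (at t within I)) \<mu> \<and>
        n t = pinner (vector_derivative v2 (at t within I)) \<mu>)"

definition AdS_parallel ::
  "real \<Rightarrow> real \<Rightarrow> (real \<Rightarrow> real) \<Rightarrow> (real \<Rightarrow> real) \<Rightarrow>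
   (real \<Rightarrow> real^4) \<Rightarrow> (real \<Rightarrow> real^4) \<Rightarrow> (real \<Rightarrow> real^4) \<Rightarrow> real \<Rightarrow> real^4" where
  "AdS_parallel f g P R \<gamma> v1 v2 = (\<lambda>t. f *\<^sub>R \<gamma> t + g *\<^sub>R (P t *\<^sub>R v1 t + R t *\<^sub>R v2 t))"

section \<open>Existence and uniqueness of the triple product\<close>

lemma vector_4_nth:
  "(vector [x, u, v, w] :: 'a::zero^4) $ 1 = x"
  "(vector [x, u, v, w] :: 'a::zero^4) $ 2 = u"
  "(vector [x, u, v, w] :: 'a::zero^4) $ 3 = v"
  "(vector [x, u, v, w] :: 'a::zero^4) $ 4 = w"
  unfolding vector_def by simp_all

lemma pinner_axis:
  "pinner (axis 1 1) y = - (y$1)" "pinner (axis 2 1) y = - (y$2)"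
  "pinner (axis 3 1) y = y$3" "pinner (axis 4 1) y = y$4"
  by (simp_all add: pinner_def axis_def)

lemma pinner_nondegenerate:
  assumes "\<And>x. pinner x y = pinner x z"
  shows "y = z"
proof -
  have "y$1 = z$1" "y$2 = z$2" "y$3 = z$3" "y$4 = z$4"
    using assms[of "axis 1 1"] assms[of "axis 2 1"] assms[of "axis 3 1"] assms[of "axis 4 1"]
    by (simp_all add: pinner_axis)
  then show ?thesis by (simp add: vec_eq_iff forall_4)
qed

lemma det_row1_linear:
  "det (vector [a *\<^sub>R x + b *\<^sub>R y, u, v, w] :: real^4^4) =
     a * det (vector [x, u, v, w] :: real^4^4) + b * det (vector [y, u, v, w] :: real^4^4)"
proof -
  have row: "(vector [z, u, v, w] :: real^4^4) =
      (\<chi> i. if i = 1 then z else (vector [0, u, v, w] :: real^4^4) $ i)" for z :: "real^4"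
    by (simp add: vec_eq_iff forall_4 vector_4_nth)
  have s: "c *s z = c *\<^sub>R z" for c and z :: "real^4" by (simp add: vec_eq_iff)
  show ?thesis
    unfolding row[of "a *\<^sub>R x + b *\<^sub>R y"] row[of x] row[of y]
    using det_row_add[of 1 "\<lambda>i. a *\<^sub>R x" "\<lambda>i. b *\<^sub>R y" "\<lambda>i. (vector [0, u, v, w] :: real^4^4) $ i"]
      det_row_mul[of 1 a "\<lambda>i. x" "\<lambda>i. (vector [0, u, v, w] :: real^4^4) $ i"]
      det_row_mul[of 1 b "\<lambda>i. y" "\<lambda>i. (vector [0, u, v, w] :: real^4^4) $ i"]
    unfolding s by simp
qed

lemma triple_unique:
  "\<exists>!y. \<forall>x. pinner x y = det (vector [x, u, v, w] :: real^4^4)"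
proof -
  define D where "D = (\<lambda>x. det (vector [x, u, v, w] :: real^4^4))"
  have lin: "D (a *\<^sub>R x + b *\<^sub>R y) = a * D x + b * D y" for a b x y
    unfolding D_def by (rule det_row1_linear)
  define y where "y = (vector [- D (axis 1 1), - D (axis 2 1), D (axis 3 1), D (axis 4 1)] :: real^4)"
  have "pinner x y = D x" for x
  proof -
    have x: "x = 1 *\<^sub>R (x$1 *\<^sub>R axis 1 1 + x$2 *\<^sub>R axis 2 1)
        + 1 *\<^sub>R (x$3 *\<^sub>R axis 3 1 + x$4 *\<^sub>R axis 4 1)"
      by (simp add: vec_eq_iff forall_4 axis_def)
    show ?thesis
      by (subst (2) x, unfold lin) (simp add: pinner_def y_def vector_4_nth)
  qed
  then show ?thesis
    unfolding D_def by (metis pinner_nondegenerate)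
qed

lemma pinner_triple: "pinner x (triple u v w) = det (vector [x, u, v, w] :: real^4^4)"
  using theI'[OF triple_unique[of u v w]] unfolding triple_def by blast

end

theory Submission
  imports Defs
begin

text \<open>Put \<open>w = P v\<^sub>1 + R v\<^sub>2\<close>, \<open>z = v\<^sub>2\<^sup>\<phi>\<close>, \<open>\<delta> = P\<^sup>2 - R\<^sup>2\<close> and \<open>\<sigma> = \<epsilon> \<delta>\<close>; both signs are
  constant. The pair \<open>(w, z)\<close> is the hyperbolic rotation of \<open>(v\<^sub>1, v\<^sub>2)\<close> by \<open>\<theta>\<close>, and \<open>\<theta>' = - l\<close> makes
  the \<open>z\<close>-component of \<open>w'\<close> vanish, so \<open>w'\<close> is orthogonal to \<open>\<gamma>\<close>, \<open>w\<close> and \<open>z\<close>. The pair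
  \<open>(\<gamma>\<^sup>\<phi>, v\<^sub>1\<^sup>\<phi>)\<close> comes from \<open>(\<gamma>, w)\<close> by a constant linear map whose determinant
  \<open>f\<^sup>2 - \<sigma> g\<^sup>2\<close> is \<open>1\<close>, so the new normal is \<open>\<delta> \<mu>\<close> and all the claims follow by bilinearity.\<close>

section \<open>Smooth functions on a set without isolated points\<close>

text \<open>Smoothness of finite order: index \<open>k\<close> stands for \<open>k + 1\<close>
  derivatives. The recursion peels off the innermost derivative, whereas
  \<open>smooth_on_interval\<close> iterates at the outermost place, so inductions on
  \<open>k\<close> can use their hypothesis for the derivative of \<open>h\<close>.\<close>

primrec diff_times :: "nat \<Rightarrow> real set \<Rightarrow> (real \<Rightarrow> 'a::real_normed_vector) \<Rightarrow> bool" where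
  "diff_times 0 I h \<longleftrightarrow> h differentiable_on I"
| "diff_times (Suc k) I h \<longleftrightarrow>
     h differentiable_on I \<and> diff_times k I (\<lambda>t. vector_derivative h (at t within I))"

lemma smooth_on_interval_iff_diff_times:
  "smooth_on_interval I h \<longleftrightarrow> (\<forall>k. diff_times k I h)"
proof -
  let ?D = "\<lambda>g t. vector_derivative g (at t within I)"
  have "diff_times k I h \<longleftrightarrow> (\<forall>j\<le>k. (?D ^^ j) h differentiable_on I)" for k
  proof (induction k arbitrary: h)
    case (Suc k)
    have "(\<forall>j\<le>Suc k. (?D ^^ j) h differentiable_on I) \<longleftrightarrow>
        h differentiable_on I \<and> (\<forall>j\<le>k. (?D ^^ Suc j) h differentiable_on I)"
      using All_less_Suc2[of "Suc k" "\<lambda>j. (?D ^^ j) h differentiable_on I"]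
      by (simp only: less_Suc_eq_le funpow_0)
    \<comment> \<open>\<open>funpow_Suc_right\<close> moves the extra derivative to the innermost
      place, where the induction hypothesis applies to it.\<close>
    then show ?case by (simp add: Suc.IH funpow_Suc_right del: funpow.simps(2))
  qed simp
  then show ?thesis by (auto simp: smooth_on_interval_def)
qed

lemma diff_times_imp_differentiable_on: "diff_times k I h \<Longrightarrow> h differentiable_on I"
  by (cases k) auto

lemma diff_times_SucD: "diff_times (Suc k) I h \<Longrightarrow> diff_times k I h"
  by (induction k arbitrary: h) auto

lemma differentiable_on_has_vector_derivative:
  assumes "h differentiable_on I" "t \<in> I"
  shows "(h has_vector_derivative vector_derivative h (at t within I)) (at t within I)"
  using assms by (simp add: differentiable_on_def vector_derivative_works[symmetric])

lemma smooth_on_interval_has_vector_derivative: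
  assumes "smooth_on_interval I h" "t \<in> I"
  shows "(h has_vector_derivative vector_derivative h (at t within I)) (at t within I)"
proof -
  have "diff_times 0 I h" using assms by (simp only: smooth_on_interval_iff_diff_times)
  then show ?thesis using assms(2) by (simp add: differentiable_on_has_vector_derivative)
qed

lemma has_vector_derivative_cosh_sinh:
  fixes \<theta> :: "real \<Rightarrow> real"
  assumes "(\<theta> has_vector_derivative \<theta>') (at t within S)"
  shows "((\<lambda>t. cosh (\<theta> t)) has_vector_derivative \<theta>' *\<^sub>R sinh (\<theta> t)) (at t within S)"
    and "((\<lambda>t. sinh (\<theta> t)) has_vector_derivative \<theta>' *\<^sub>R cosh (\<theta> t)) (at t within S)"
  using assms
  by (auto simp flip: has_real_derivative_iff_has_vector_derivative intro!: derivative_eq_intros)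

context
  fixes I :: "real set"
  assumes perfect: "\<And>t. t \<in> I \<Longrightarrow> t islimpt I"
begin

text \<open>At a limit point of \<open>I\<close> a derivative within \<open>I\<close> is unique. At
  an isolated point every vector is one, and \<open>vector_derivative\<close> would be an arbitrary
  choice.\<close>

lemma vector_derivative_within_perfect:
  assumes "(h has_vector_derivative h') (at t within I)" "t \<in> I"
  shows "vector_derivative h (at t within I) = h'"
  using assms perfect by (simp add: vector_derivative_within trivial_limit_within)

text \<open>Derivatives within \<open>I\<close> see only values on \<open>I\<close>. Formulas for
  \<open>vector_derivative\<close> are known only at points of \<open>I\<close>, so they cannot be
  used as equations between functions.\<close>

lemma diff_times_cong:
  assumes "\<And>t. t \<in> I \<Longrightarrow> h t = k t" "diff_times i I h"
  shows "diff_times i I k"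
  using assms
proof (induction i arbitrary: h k)
  case 0
  \<comment> \<open>The radius 1 is arbitrary, since the two functions agree on all of
    \<open>I\<close>.\<close>
  then show ?case by (auto simp: differentiable_on_def intro: differentiable_transform_within[OF _ zero_less_one])
next
  case (Suc i)
  have k: "(k has_vector_derivative vector_derivative h (at t within I)) (at t within I)"
    if "t \<in> I" for t
    by (rule has_vector_derivative_transform[OF that _ differentiable_on_has_vector_derivative])
      (use Suc.prems that in auto)
  have "k differentiable_on I"
    using k by (auto simp: differentiable_on_def intro: differentiableI_vector)
  moreover have "diff_times i I (\<lambda>t. vector_derivative k (at t within I))"
    by (rule Suc.IH[where h = "\<lambda>t. vector_derivative h (at t within I)"])
      (use Suc.prems k in \<open>auto intro: vector_derivative_within_perfect[symmetric]\<close>)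
  ultimately show ?case by simp
qed

text \<open>Lets any explicit derivative on \<open>I\<close> replace
  \<open>vector_derivative\<close>; the closure properties below are inductions through this
  rule.\<close>

lemma diff_times_SucI:
  assumes der: "\<And>t. t \<in> I \<Longrightarrow> (h has_vector_derivative h' t) (at t within I)"
    and h': "diff_times i I h'"
  shows "diff_times (Suc i) I h"
proof -
  have "h differentiable_on I"
    using der by (auto simp: differentiable_on_def intro: differentiableI_vector)
  moreover have "diff_times i I (\<lambda>t. vector_derivative h (at t within I))"
    by (rule diff_times_cong[OF vector_derivative_within_perfect[OF der, symmetric] h'])
  ultimately show ?thesis by simp
qed

lemma diff_times_const: "diff_times i I (\<lambda>t. c)"
proof (induction i arbitrary: c)
  case (Suc i)
  show ?case by (rule diff_times_SucI[where h' = "\<lambda>t. 0"]) (auto intro: Suc.IH)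
qed simp

lemma diff_times_add:
  assumes "diff_times i I h" "diff_times i I k"
  shows "diff_times i I (\<lambda>t. h t + k t)"
  using assms
proof (induction i arbitrary: h k)
  case (Suc i)
  show ?case
    by (rule diff_times_SucI[OF has_vector_derivative_add])
      (use Suc in \<open>auto intro: differentiable_on_has_vector_derivative\<close>)
qed (simp add: differentiable_on_add)

lemma diff_times_scaleR:
  assumes "diff_times i I c" "diff_times i I h"
  shows "diff_times i I (\<lambda>t. c t *\<^sub>R h t)"
  using assms
proof (induction i arbitrary: c h)
  case 0
  then show ?case by (auto simp: differentiable_on_def)
next
  case (Suc i)
  \<comment> \<open>The Leibniz rule leaves one factor undifferentiated in each term, so both
    factors are also needed at the lower order.\<close>
  have lower: "diff_times i I c" "diff_times i I h"
    using Suc.prems by (blast intro: diff_times_SucD)+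
  have der: "(c has_real_derivative vector_derivative c (at t within I)) (at t within I)"
      "(h has_vector_derivative vector_derivative h (at t within I)) (at t within I)"
    if "t \<in> I" for t
    using Suc.prems that
    by (auto intro: differentiable_on_has_vector_derivative
        simp: has_real_derivative_iff_has_vector_derivative)
  show ?case
    by (rule diff_times_SucI[OF has_vector_derivative_scaleR[OF der]])
      (use Suc.prems lower in \<open>auto intro!: diff_times_add Suc.IH\<close>)
qed

text \<open>The derivative of each function is a multiple of the other, so the induction treats both
  at once.\<close>

lemma diff_times_cosh_sinh:
  assumes "diff_times i I \<theta>"
  shows "diff_times i I (\<lambda>t. cosh (\<theta> t :: real)) \<and> diff_times i I (\<lambda>t. sinh (\<theta> t))"
  using assms
proof (induction i)
  case 0
  then have "(\<theta> has_vector_derivative vector_derivative \<theta> (at t within I)) (at t within I)"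
    if "t \<in> I" for t
    using that by (simp add: differentiable_on_has_vector_derivative)
  from has_vector_derivative_cosh_sinh[OF this] show ?case
    by (auto simp: differentiable_on_def intro: differentiableI_vector)
next
  case (Suc i)
  let ?D = "\<lambda>t. vector_derivative \<theta> (at t within I)"
  have der: "(\<theta> has_vector_derivative ?D t) (at t within I)" if "t \<in> I" for t
    using Suc.prems that by (simp add: differentiable_on_has_vector_derivative)
  have IH: "diff_times i I (\<lambda>t. cosh (\<theta> t))" "diff_times i I (\<lambda>t. sinh (\<theta> t))"
    using Suc.IH diff_times_SucD[OF Suc.prems] by auto
  have D: "diff_times i I ?D" using Suc.prems by simp
  show ?case
    using diff_times_SucI[OF has_vector_derivative_cosh_sinh(1)[OF der] diff_times_scaleR[OF D IH(2)]]
      diff_times_SucI[OF has_vector_derivative_cosh_sinh(2)[OF der] diff_times_scaleR[OF D IH(1)]]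
    by blast
qed

lemma smooth_on_interval_const: "smooth_on_interval I (\<lambda>t. c)"
  by (simp add: smooth_on_interval_iff_diff_times diff_times_const)

lemma smooth_on_interval_add:
  "smooth_on_interval I h \<Longrightarrow> smooth_on_interval I k \<Longrightarrow> smooth_on_interval I (\<lambda>t. h t + k t)"
  by (simp add: smooth_on_interval_iff_diff_times diff_times_add)

lemma smooth_on_interval_scaleR:
  "smooth_on_interval I c \<Longrightarrow> smooth_on_interval I h \<Longrightarrow> smooth_on_interval I (\<lambda>t. c t *\<^sub>R h t)"
  by (simp add: smooth_on_interval_iff_diff_times diff_times_scaleR)

lemma smooth_on_interval_cosh_sinh:
  assumes "smooth_on_interval I \<theta>"
  shows "smooth_on_interval I (\<lambda>t. cosh (\<theta> t :: real))" "smooth_on_interval I (\<lambda>t. sinh (\<theta> t))"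
  using assms by (simp_all add: smooth_on_interval_iff_diff_times diff_times_cosh_sinh)

end

section \<open>The scalar product and the triple product\<close>

lemma pinner_commute: "pinner u w = pinner w u"
  by (simp add: pinner_def mult.commute)

lemma pinner_linear:
  "pinner (u + v) w = pinner u w + pinner v w"
  "pinner w (u + v) = pinner w u + pinner w v"
  "pinner (u - v) w = pinner u w - pinner v w"
  "pinner (c *\<^sub>R u) w = c * pinner u w"
  "pinner w (c *\<^sub>R u) = c * pinner w u"
  by (simp_all add: pinner_def algebra_simps)

text \<open>Bilinear maps in finite dimension are bounded; this gives access to the general product
  rule.\<close>

lemma bounded_bilinear_pinner: "bounded_bilinear pinner"
proof -
  have "bilinear pinner"
    by (auto simp: bilinear_def pinner_linear intro!: linearI)
  then show ?thesis by (simp add: bilinear_conv_bounded_bilinear)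
qed

text \<open>The product rule for a constant function, whose derivative within \<open>I\<close> is
  uniquely 0 at a limit point. It turns each relation between frame vectors into one for their
  derivatives.\<close>

lemma pinner_constant_derivative:
  assumes const: "\<forall>t\<in>I. pinner (u t) (w t) = c" and t: "t \<in> I" "t islimpt I"
    and u: "(u has_vector_derivative u') (at t within I)"
    and w: "(w has_vector_derivative w') (at t within I)"
  shows "pinner u' (w t) = - pinner (u t) w'"
proof -
  have "((\<lambda>t. pinner (u t) (w t)) has_vector_derivative pinner (u t) w' + pinner u' (w t))
      (at t within I)"
    by (rule bounded_bilinear.has_vector_derivative[OF bounded_bilinear_pinner u w])
  moreover have "((\<lambda>t. pinner (u t) (w t)) has_vector_derivative 0) (at t within I)"
    by (rule has_vector_derivative_transform[OF t(1) _ has_vector_derivative_const[of c]])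
      (use const in auto)
  ultimately have "pinner (u t) w' + pinner u' (w t) = 0"
    using t(2) vector_derivative_unique_within trivial_limit_within by blast
  then show ?thesis by simp
qed

text \<open>Laplace expansion along the first row, with the minors written out by Sarrus' rule. The
  permutations are enumerated by splitting off 1, 2 and 3 in turn.\<close>

lemma det_4:
  "det (A :: 'a::comm_ring_1^4^4) =
    A$1$1 * (A$2$2 * A$3$3 * A$4$4 + A$2$3 * A$3$4 * A$4$2 + A$2$4 * A$3$2 * A$4$3
           - A$2$2 * A$3$4 * A$4$3 - A$2$3 * A$3$2 * A$4$4 - A$2$4 * A$3$3 * A$4$2)
  - A$1$2 * (A$2$1 * A$3$3 * A$4$4 + A$2$3 * A$3$4 * A$4$1 + A$2$4 * A$3$1 * A$4$3
           - A$2$1 * A$3$4 * A$4$3 - A$2$3 * A$3$1 * A$4$4 - A$2$4 * A$3$3 * A$4$1)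
  + A$1$3 * (A$2$1 * A$3$2 * A$4$4 + A$2$2 * A$3$4 * A$4$1 + A$2$4 * A$3$1 * A$4$2
           - A$2$1 * A$3$4 * A$4$2 - A$2$2 * A$3$1 * A$4$4 - A$2$4 * A$3$2 * A$4$1)
  - A$1$4 * (A$2$1 * A$3$2 * A$4$3 + A$2$2 * A$3$3 * A$4$1 + A$2$3 * A$3$1 * A$4$2
           - A$2$1 * A$3$3 * A$4$2 - A$2$2 * A$3$1 * A$4$3 - A$2$3 * A$3$2 * A$4$1)"
proof -
  have f: "finite {2::4, 3, 4}" "1 \<notin> {2::4, 3, 4}" "finite {3::4, 4}" "2 \<notin> {3::4, 4}"
      "finite {4::4}" "3 \<notin> {4::4}"
    by auto
  show ?thesis
    unfolding det_def UNIV_4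
    unfolding sum_over_permutations_insert[OF f(1,2)]
    unfolding sum_over_permutations_insert[OF f(3,4)]
    unfolding sum_over_permutations_insert[OF f(5,6)]
    unfolding permutes_sing
    by (simp add: sign_swap_id permutation_swap_id sign_compose sign_id swap_id_eq
        permutation_compose, simp add: algebra_simps)
qed

text \<open>A determinant with two equal rows vanishes.\<close>

lemma pinner_triple_self: "pinner v (triple u v w) = 0" "pinner w (triple u v w) = 0"
  by (simp_all add: pinner_triple det_4 vector_4_nth algebra_simps)

text \<open>The determinant is alternating and multilinear in its rows, so a linear change of two
  arguments contributes its 2x2 determinant. Nondegeneracy reduces the vector equation to this
  one.\<close>

lemma triple_combine12:
  "triple (a *\<^sub>R u + b *\<^sub>R v) (c *\<^sub>R u + d *\<^sub>R v) w = (a * d - b * c) *\<^sub>R triple u v w"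
  by (rule pinner_nondegenerate)
    (simp only: pinner_linear pinner_triple det_4 vector_4_nth vector_add_component
      vector_scaleR_component real_scaleR_def, algebra)

lemma triple_combine23:
  "triple u (a *\<^sub>R v + b *\<^sub>R w) (c *\<^sub>R v + d *\<^sub>R w) = (a * d - b * c) *\<^sub>R triple u v w"
  by (rule pinner_nondegenerate)
    (simp only: pinner_linear pinner_triple det_4 vector_4_nth vector_add_component
      vector_scaleR_component real_scaleR_def, algebra)

text \<open>The factor \<open>P\<^sup>2 - R\<^sup>2\<close> in the curvature is the sign relating
  the triple product of the new frame to \<mu>. It is 1 for \<open>(cosh, sinh)\<close>; for
  \<open>(sinh, cosh)\<close> it is -1, and the last three of \<alpha>, l, m, n other than l,
  together with \<alpha>, change sign.\<close>

theorem proposition3p5: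
  fixes I :: "real set"
    and \<gamma> v1 v2 \<gamma>\<phi> v1\<phi> v2\<phi> :: "real \<Rightarrow> real^4"
    and \<alpha> l m n \<theta> P R \<alpha>\<phi> m\<phi> n\<phi> :: "real \<Rightarrow> real"
    and \<epsilon> \<phi> f g :: real
  assumes I: "is_interval I" "interior I \<noteq> {}"
    and curve: "spacelike_framed_curve I \<gamma> v1 v2"
    and curvature: "has_curvature I \<gamma> v1 v2 \<alpha> l m n"
    and eps: "\<forall>t\<in>I. \<epsilon> = pinner (v1 t) (v1 t)"
    and theta: "smooth_on_interval I \<theta>"
      "\<forall>t\<in>I. (\<theta> has_real_derivative - l t) (at t within I)"
    and PR: "(P = (\<lambda>t. cosh (\<theta> t)) \<and> R = (\<lambda>t. sinh (\<theta> t))) \<or>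
             (P = (\<lambda>t. sinh (\<theta> t)) \<and> R = (\<lambda>t. cosh (\<theta> t)))"
    and fg: "\<forall>t\<in>I. (\<epsilon> * ((P t)\<^sup>2 - (R t)\<^sup>2) = -1 \<longrightarrow> f = cos \<phi> \<and> g = sin \<phi>) \<and>
                   (\<epsilon> * ((P t)\<^sup>2 - (R t)\<^sup>2) = 1 \<longrightarrow> f = cosh \<phi> \<and> g = sinh \<phi>)"
    and gam_phi: "\<gamma>\<phi> = AdS_parallel f g P R \<gamma> v1 v2"
    and v1_phi: "v1\<phi> = (\<lambda>t. (\<epsilon> * ((P t)\<^sup>2 - (R t)\<^sup>2) * g) *\<^sub>R \<gamma> t
                          + f *\<^sub>R (P t *\<^sub>R v1 t + R t *\<^sub>R v2 t))"
    and v2_phi: "v2\<phi> = (\<lambda>t. R t *\<^sub>R v1 t + P t *\<^sub>R v2 t)"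
    and alpha_phi: "\<alpha>\<phi> = (\<lambda>t. \<alpha> t * f + g * (P t * m t + R t * n t))"
    and m_phi: "m\<phi> = (\<lambda>t. \<epsilon> * ((P t)\<^sup>2 - (R t)\<^sup>2) * g * \<alpha> t + f * (P t * m t + R t * n t))"
    and n_phi: "n\<phi> = (\<lambda>t. R t * m t + P t * n t)"
  shows "spacelike_framed_curve I \<gamma>\<phi> v1\<phi> v2\<phi> \<and>
         has_curvature I \<gamma>\<phi> v1\<phi> v2\<phi>
           (\<lambda>t. ((P t)\<^sup>2 - (R t)\<^sup>2) * \<alpha>\<phi> t) (\<lambda>t. 0)
           (\<lambda>t. ((P t)\<^sup>2 - (R t)\<^sup>2) * m\<phi> t) (\<lambda>t. ((P t)\<^sup>2 - (R t)\<^sup>2) * n\<phi> t)"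
proof -
  \<comment> \<open>Nonempty interior excludes singletons, and a connected set that is not a
    singleton has no isolated points.\<close>
  have "connected I" "I \<noteq> {t}" for t
    using I by (auto simp: is_interval_connected)
  then have perfect: "t islimpt I" if "t \<in> I" for t
    using connected_imp_perfect that by blast
  have "I \<noteq> {}" using I interior_subset by fastforce
  \<comment> \<open>Both orders of the factors of \<open>Delta1\<close> are covered by norms
    \<epsilon> and -\<epsilon> with square 1; a point of \<open>I\<close> is needed to read off the
    last fact.\<close>
  have smooth: "smooth_on_interval I \<gamma>" "smooth_on_interval I v1" "smooth_on_interval I v2"
    and frame: "\<forall>t\<in>I. pinner (\<gamma> t) (\<gamma> t) = -1" "\<forall>t\<in>I. pinner (\<gamma> t) (v1 t) = 0"
      "\<forall>t\<in>I. pinner (\<gamma> t) (v2 t) = 0" "\<forall>t\<in>I. pinner (v1 t) (v2 t) = 0"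
      "\<forall>t\<in>I. pinner (v1 t) (v1 t) = \<epsilon>" "\<forall>t\<in>I. pinner (v2 t) (v2 t) = - \<epsilon>"
    and eps_sq: "\<epsilon> * \<epsilon> = 1"
    using curve eps \<open>I \<noteq> {}\<close>
    by (auto simp: spacelike_framed_curve_def Delta1_def AdS3_def S32_def)
  obtain \<delta> where \<delta>: "\<And>t. (P t)\<^sup>2 - (R t)\<^sup>2 = \<delta>" and \<delta>_sq: "\<delta> * \<delta> = 1"
    using PR
  proof (elim disjE conjE)
    assume "P = (\<lambda>t. cosh (\<theta> t))" "R = (\<lambda>t. sinh (\<theta> t))"
    then show ?thesis using that[of 1] by (simp add: cosh_square_eq)
  next
    assume "P = (\<lambda>t. sinh (\<theta> t))" "R = (\<lambda>t. cosh (\<theta> t))"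
    then show ?thesis using that[of "-1"] by (simp add: cosh_square_eq)
  qed
  define \<sigma> where "\<sigma> = \<epsilon> * \<delta>"
  have "\<sigma> * \<sigma> = 1"
    using eps_sq \<delta>_sq by (simp add: \<sigma>_def algebra_simps)
  then have \<sigma>: "\<sigma> = 1 \<or> \<sigma> = -1" by (simp add: square_eq_1_iff)
  have "\<sigma> = -1 \<longrightarrow> f = cos \<phi> \<and> g = sin \<phi>" "\<sigma> = 1 \<longrightarrow> f = cosh \<phi> \<and> g = sinh \<phi>"
    using fg \<open>I \<noteq> {}\<close> unfolding \<delta> \<sigma>_def[symmetric] by auto
  \<comment> \<open>The circular and hyperbolic Pythagorean identities merge into one equation
    through \<sigma>.\<close>
  then have fg_sq: "f * f - \<sigma> * (g * g) = 1"
    using \<sigma> cosh_square_eq[of \<phi>] sin_cos_squared_add[of \<phi>] by (auto simp: power2_eq_square)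

  \<comment> \<open>With \<open>P' = - l R\<close> and \<open>R' = - l P\<close>, differentiating
    the coefficients of \<open>w\<close> gives \<open>- l z\<close>, and those of \<open>z\<close>
    give \<open>- l w\<close>, where \<open>z\<close> is \<open>v2\<phi>\<close>.\<close>
  define w w' z' :: "real \<Rightarrow> real^4"
    where "w = (\<lambda>t. P t *\<^sub>R v1 t + R t *\<^sub>R v2 t)"
      and "w' = (\<lambda>t. P t *\<^sub>R vector_derivative v1 (at t within I)
        + R t *\<^sub>R vector_derivative v2 (at t within I) - l t *\<^sub>R v2\<phi> t)"
      and "z' = (\<lambda>t. R t *\<^sub>R vector_derivative v1 (at t within I)
        + P t *\<^sub>R vector_derivative v2 (at t within I) - l t *\<^sub>R w t)"
  have \<gamma>\<phi>: "\<gamma>\<phi> = (\<lambda>t. f *\<^sub>R \<gamma> t + g *\<^sub>R w t)"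
    by (simp add: gam_phi AdS_parallel_def w_def)
  have v1\<phi>: "v1\<phi> = (\<lambda>t. (\<sigma> * g) *\<^sub>R \<gamma> t + f *\<^sub>R w t)"
    by (simp add: v1_phi w_def \<sigma>_def \<delta>)

  have "smooth_on_interval I P" "smooth_on_interval I R"
    using PR smooth_on_interval_cosh_sinh[OF perfect theta(1)] by auto
  then have smooth_phi: "smooth_on_interval I \<gamma>\<phi>" "smooth_on_interval I v1\<phi>" "smooth_on_interval I v2\<phi>"
    unfolding \<gamma>\<phi> v1\<phi> v2_phi w_def
    by (auto intro!: smooth_on_interval_add smooth_on_interval_scaleR smooth_on_interval_const
        perfect smooth)

  have pointwise: "pinner (\<gamma>\<phi> t) (\<gamma>\<phi> t) = -1 \<and> pinner (v1\<phi> t) (v1\<phi> t) = \<sigma> \<and>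
      pinner (v2\<phi> t) (v2\<phi> t) = - \<sigma> \<and> pinner (v1\<phi> t) (v2\<phi> t) = 0 \<and>
      pinner (\<gamma>\<phi> t) (v1\<phi> t) = 0 \<and> pinner (\<gamma>\<phi> t) (v2\<phi> t) = 0 \<and>
      pinner (vector_derivative \<gamma>\<phi> (at t within I)) (v1\<phi> t) = 0 \<and>
      pinner (vector_derivative \<gamma>\<phi> (at t within I)) (v2\<phi> t) = 0 \<and>
      pinner (vector_derivative v1\<phi> (at t within I)) (v2\<phi> t) = 0 \<and>
      \<delta> * \<alpha>\<phi> t = pinner (vector_derivative \<gamma>\<phi> (at t within I)) (triple (\<gamma>\<phi> t) (v1\<phi> t) (v2\<phi> t)) \<and>
      \<delta> * m\<phi> t = pinner (vector_derivative v1\<phi> (at t within I)) (triple (\<gamma>\<phi> t) (v1\<phi> t) (v2\<phi> t)) \<and>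
      \<delta> * n\<phi> t = pinner (vector_derivative v2\<phi> (at t within I)) (triple (\<gamma>\<phi> t) (v1\<phi> t) (v2\<phi> t))"
    if t: "t \<in> I" for t
  proof -
    define d\<gamma> d1 d2 \<mu>
      where "d\<gamma> = vector_derivative \<gamma> (at t within I)"
        and "d1 = vector_derivative v1 (at t within I)"
        and "d2 = vector_derivative v2 (at t within I)"
        and "\<mu> = triple (\<gamma> t) (v1 t) (v2 t)"
    note d_defs = d\<gamma>_def d1_def d2_def
    have der: "(\<gamma> has_vector_derivative d\<gamma>) (at t within I)"
        "(v1 has_vector_derivative d1) (at t within I)"
        "(v2 has_vector_derivative d2) (at t within I)"
      unfolding d_defs using smooth t by (auto intro: smooth_on_interval_has_vector_derivative)
    have "(\<theta> has_vector_derivative - l t) (at t within I)"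
      using theta(2) t by (simp add: has_real_derivative_iff_has_vector_derivative)
    note hyp = has_vector_derivative_cosh_sinh[OF this]
    \<comment> \<open>Differentiation exchanges cosh and sinh, so both choices of
      \<open>(P, R)\<close> obey the same equations.\<close>
    have "(P has_vector_derivative - l t *\<^sub>R R t) (at t within I)"
      "(R has_vector_derivative - l t *\<^sub>R P t) (at t within I)"
      using PR hyp by auto
    then have PR': "(P has_real_derivative - l t * R t) (at t within I)"
      "(R has_real_derivative - l t * P t) (at t within I)"
      by (simp_all add: has_real_derivative_iff_has_vector_derivative)
    have w: "(w has_vector_derivative w' t) (at t within I)"
      unfolding w_def w'_def v2_phi d_defs[symmetric]
      by (auto intro!: derivative_eq_intros PR' der simp: algebra_simps)
    have z: "(v2\<phi> has_vector_derivative z' t) (at t within I)"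
      unfolding w_def z'_def v2_phi d_defs[symmetric]
      by (auto intro!: derivative_eq_intros PR' der simp: algebra_simps)
    have D\<phi>: "vector_derivative \<gamma>\<phi> (at t within I) = f *\<^sub>R d\<gamma> + g *\<^sub>R w' t"
      "vector_derivative v1\<phi> (at t within I) = (\<sigma> * g) *\<^sub>R d\<gamma> + f *\<^sub>R w' t"
      "vector_derivative v2\<phi> (at t within I) = z' t"
      using z unfolding \<gamma>\<phi> v1\<phi>
      by (auto intro!: vector_derivative_within_perfect[OF perfect _ t] derivative_eq_intros der w)

    \<comment> \<open>Scalar products of the original frame with its derivatives\<close>
    note const = pinner_constant_derivative[OF _ t perfect[OF t]]
    have "l t = - \<epsilon> * pinner d1 (v2 t)"
      using curvature frame(5) t by (simp add: has_curvature_def Let_def d_defs)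
    then have l: "pinner d1 (v2 t) = - \<epsilon> * l t"
      using eps_sq by (simp flip: mult.assoc)
    have PR_t: "P t * P t - R t * R t = \<delta>"
      using \<delta>[of t] by (simp add: power2_eq_square)
    have frame_t: "pinner (\<gamma> t) (\<gamma> t) = -1" "pinner (\<gamma> t) (v1 t) = 0"
      "pinner (\<gamma> t) (v2 t) = 0" "pinner (v1 t) (v2 t) = 0"
      "pinner (v1 t) (v1 t) = \<epsilon>" "pinner (v2 t) (v2 t) = - \<epsilon>"
      using frame t by auto
    have tangent: "pinner d\<gamma> (v1 t) = 0" "pinner d\<gamma> (v2 t) = 0"
      using curve t by (simp_all add: spacelike_framed_curve_def d_defs)
    \<comment> \<open>Each of the six frame relations is differentiated; orthogonality of
      \<open>v1\<close> and \<open>v2\<close> transfers the value for \<open>d1\<close> to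
      \<open>d2\<close> with opposite sign.\<close>
    have diff: "pinner d\<gamma> (\<gamma> t) = 0" "pinner d\<gamma> (v1 t) = 0" "pinner d\<gamma> (v2 t) = 0"
        "pinner d1 (\<gamma> t) = 0" "pinner d2 (\<gamma> t) = 0" "pinner d1 (v1 t) = 0" "pinner d2 (v2 t) = 0"
        "pinner d1 (v2 t) = - \<epsilon> * l t" "pinner d2 (v1 t) = \<epsilon> * l t"
      using tangent l const[OF frame(1) der(1) der(1)] const[OF frame(2) der(1) der(2)]
        const[OF frame(3) der(1) der(3)] const[OF frame(4) der(2) der(3)]
        const[OF frame(5) der(2) der(2)] const[OF frame(6) der(3) der(3)]
      by (simp_all add: pinner_commute[of _ d1] pinner_commute[of _ d2] pinner_commute[of _ d\<gamma>])
    have \<mu>: "pinner d\<gamma> \<mu> = \<alpha> t" "pinner d1 \<mu> = m t" "pinner d2 \<mu> = n t"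
      using curvature t by (simp_all add: has_curvature_def Let_def \<mu>_def d_defs)
    have \<mu>0: "pinner (v1 t) \<mu> = 0" "pinner (v2 t) \<mu> = 0"
      by (simp_all add: \<mu>_def pinner_triple_self)
    have triple: "triple (\<gamma>\<phi> t) (v1\<phi> t) (v2\<phi> t) = \<delta> *\<^sub>R \<mu>"
    proof -
      \<comment> \<open>Two changes of basis are undone in turn: first the one of determinant 1 by
        \<open>fg_sq\<close>, then the one of determinant \<delta>.\<close>
      have "triple (\<gamma>\<phi> t) (v1\<phi> t) (v2\<phi> t) =
          (f * f - g * (\<sigma> * g)) *\<^sub>R triple (\<gamma> t) (w t) (v2\<phi> t)"
        by (simp add: \<gamma>\<phi> v1\<phi> triple_combine12)
      also have "\<dots> = (P t * P t - R t * R t) *\<^sub>R \<mu>"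
        using fg_sq by (simp add: w_def v2_phi triple_combine23 \<mu>_def mult.left_commute[of g])
      finally show ?thesis
        by (simp add: PR_t)
    qed

    \<comment> \<open>Scalar products of the rotated frame\<close>
    note lin = pinner_linear pinner_commute[of "v2 t" "v1 t"]
    have w_z_orth: "pinner (\<gamma> t) (w t) = 0" "pinner (\<gamma> t) (v2\<phi> t) = 0"
        "pinner d\<gamma> (w t) = 0" "pinner d\<gamma> (v2\<phi> t) = 0" "pinner (w t) (v2\<phi> t) = 0"
        "pinner (w t) \<mu> = 0" "pinner (v2\<phi> t) \<mu> = 0"
      using frame_t diff \<mu>0 by (simp_all add: w_def v2_phi lin)
    have "pinner (w t) (w t) = \<epsilon> * (P t * P t - R t * R t)"
        "pinner (v2\<phi> t) (v2\<phi> t) = - \<epsilon> * (P t * P t - R t * R t)"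
      using frame_t by (simp_all add: w_def v2_phi lin algebra_simps)
    then have w_z_norm: "pinner (w t) (w t) = \<sigma>" "pinner (v2\<phi> t) (v2\<phi> t) = - \<sigma>"
      by (simp_all add: PR_t \<sigma>_def)
    have d_w_z: "pinner d1 (w t) = - (R t * \<epsilon> * l t)" "pinner d2 (w t) = P t * \<epsilon> * l t"
        "pinner d1 (v2\<phi> t) = - (P t * \<epsilon> * l t)" "pinner d2 (v2\<phi> t) = R t * \<epsilon> * l t"
      using diff by (simp_all add: w_def v2_phi lin)
    \<comment> \<open>The first term comes from \<open>d1\<close> and \<open>d2\<close>, the second
      from \<open>- l z\<close> and the norm -\<sigma> of \<open>z\<close>. They cancel, which is
      the purpose of the condition \<theta>' = -l.\<close>
    have "pinner (w' t) (v2\<phi> t) = - \<epsilon> * l t * (P t * P t - R t * R t) + l t * \<sigma>"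
      using w_z_norm d_w_z by (simp add: w'_def d_defs[symmetric] pinner_linear algebra_simps)
    then have w'_z: "pinner (w' t) (v2\<phi> t) = 0"
      by (simp add: PR_t \<sigma>_def)
    \<comment> \<open>Of \<open>z'\<close> only the product with \<mu> is computed, because the
      derivative of the last frame vector enters the curvature only through
      \<open>n\<close>.\<close>
    have w'_inner: "pinner (w' t) (\<gamma> t) = 0" "pinner (w' t) (w t) = 0"
        "pinner (w' t) \<mu> = P t * m t + R t * n t" "pinner (z' t) \<mu> = n\<phi> t"
      using diff w_z_orth d_w_z \<mu>
      by (simp_all add: w'_def z'_def n_phi d_defs[symmetric] pinner_linear
          pinner_commute[of "v2\<phi> t" "w t"] pinner_commute[of "v2\<phi> t" "\<gamma> t"])

    \<comment> \<open>Passage to the parallel frame\<close>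
    have "pinner (\<gamma>\<phi> t) (\<gamma>\<phi> t) = - (f * f - \<sigma> * (g * g))"
        "pinner (v1\<phi> t) (v1\<phi> t) = \<sigma> * (f * f) - (\<sigma> * \<sigma>) * (g * g)"
      using frame_t w_z_orth w_z_norm
      by (simp_all add: \<gamma>\<phi> v1\<phi> pinner_linear pinner_commute[of "w t" "\<gamma> t"] algebra_simps)
    \<comment> \<open>Factoring out \<sigma> exposes the left side of \<open>fg_sq\<close>.\<close>
    moreover have "\<sigma> * (f * f) - (\<sigma> * \<sigma>) * (g * g) = \<sigma> * (f * f - \<sigma> * (g * g))"
      by (simp add: algebra_simps)
    ultimately have "pinner (\<gamma>\<phi> t) (\<gamma>\<phi> t) = -1" "pinner (v1\<phi> t) (v1\<phi> t) = \<sigma>"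
      using fg_sq by simp_all
    moreover have "pinner (\<gamma>\<phi> t) (v1\<phi> t) = 0"
        "pinner (\<gamma>\<phi> t) (v2\<phi> t) = 0" "pinner (v1\<phi> t) (v2\<phi> t) = 0"
        "pinner (f *\<^sub>R d\<gamma> + g *\<^sub>R w' t) (v1\<phi> t) = 0"
        "pinner (f *\<^sub>R d\<gamma> + g *\<^sub>R w' t) (v2\<phi> t) = 0"
        "pinner ((\<sigma> * g) *\<^sub>R d\<gamma> + f *\<^sub>R w' t) (v2\<phi> t) = 0"
      using frame_t diff w_z_orth w_z_norm w'_z w'_inner
      by (simp_all add: \<gamma>\<phi> v1\<phi> pinner_linear pinner_commute[of "w t" "\<gamma> t"])
    ultimately show ?thesis
      using w_z_norm w'_inner \<mu>
      by (simp add: D\<phi> triple pinner_linear alpha_phi m_phi \<delta> mult.commute[of f] flip: \<sigma>_def)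
  qed
  \<comment> \<open>The sign \<sigma> decides the order of the factors: -1 puts
    \<open>v1\<phi>\<close> in \<open>AdS3\<close> and \<open>v2\<phi>\<close> in
    \<open>S32\<close>, and 1 the reverse.\<close>
  show ?thesis
    using smooth_phi pointwise \<sigma>
    by (auto simp: spacelike_framed_curve_def has_curvature_def Let_def \<delta> AdS3_def S32_def Delta1_def)
qed

end
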